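(* Let $H$ be a real Hilbert space and let $C$ be a nonempty closed and convex subset of $H$. Let $T:C\to C$ be a nonexpansive mapping and let $S:C\to C$ be a nonspreading mapping such that $\mathrm{Fix}(S)\cap \mathrm{Fix}(T)\neq\emptyset$. Let $\delta\in(0,1)$ and let $A_T=(1-\delta)I+\delta T$ and $A_S=(1-\delta)I+\delta S$ be the averaged type mappings. Let $(\alpha_n)_{n\ge 1}$ be a real sequence in $(0,1)$ such that $\lim_{n\to\infty}\alpha_n=0$ and $\sum_{n=1}^\infty\alpha_n=\infty$, and let $(\beta_n)_{n\ge 1}$ be a sequence in $[0,1]$. Let $u\in C$ be fixed, let $x_1\in C$, and define $$x_{n+1}=\alpha_n u+(1-\alpha_n)\big[\beta_n A_Tx_n+(1-\beta_n)A_Sx_n\big],\qquad n\ge 1.$$ Then the following hold: (i) if $\sum_{n=1}^{\infty}(1-\beta_n)<\infty$, then $(x_n)$ converges strongly to some $p\in \mathrm{Fix}(T)$; (ii) if $\sum_{n=1}^{\infty}\beta_n<\infty$, then $(x_n)$ converges strongly to some $p\in \mathrm{Fix}(S)$; (iii) if $\liminf_{n\to\infty}\beta_n(1-\beta_n)>0$, then $(x_n)$ converges strongly to some $p\in \mathrm{Fix}(T)\cap \mathrm{Fix}(S)$.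
   Context: For a mapping $T:C\to C$, $\mathrm{Fix}(T)=\{z\in C: Tz=z\}$, and $I$ denotes the identity mapping. A mapping $T:C\to C$ is nonexpansive if $\|Tx-Ty\|\le\|x-y\|$ for all $x,y\in C$. A mapping $S:C\to C$ is nonspreading if $2\|Sx-Sy\|^2\le\|Sx-y\|^2+\|x-Sy\|^2$ for all $x,y\in C$. Strong convergence means convergence in the norm of $H$. *)

theory Defs
  imports "HOL-Analysis.Analysis"
begin

text \<open>
  A mapping \<open>T : C \<rightarrow> C\<close> is a total function on the ambient space together with the
  separate hypothesis \<open>T \<in> C \<rightarrow> C\<close>; all notions below only look at its values on \<open>C\<close>.
\<close>

definition Fix :: "'a set \<Rightarrow> ('a \<Rightarrow> 'a) \<Rightarrow> 'a set" where
  "Fix C T = {z \<in> C. T z = z}"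

definition nonexpansive_on :: "'a::real_normed_vector set \<Rightarrow> ('a \<Rightarrow> 'a) \<Rightarrow> bool" where
  "nonexpansive_on C T \<longleftrightarrow> (\<forall>x\<in>C. \<forall>y\<in>C. norm (T x - T y) \<le> norm (x - y))"

definition nonspreading_on :: "'a::real_normed_vector set \<Rightarrow> ('a \<Rightarrow> 'a) \<Rightarrow> bool" where
  "nonspreading_on C S \<longleftrightarrow>
     (\<forall>x\<in>C. \<forall>y\<in>C. 2 * (norm (S x - S y))\<^sup>2 \<le> (norm (S x - y))\<^sup>2 + (norm (x - S y))\<^sup>2)"

definition averaged :: "real \<Rightarrow> ('a::real_vector \<Rightarrow> 'a) \<Rightarrow> 'a \<Rightarrow> 'a" where
  "averaged \<delta> T x = (1 - \<delta>) *\<^sub>R x + \<delta> *\<^sub>R T x"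

end

theory Submission
  imports Defs
begin

text \<open>
  Both kinds of mappings satisfy the inequality \<open>norm (x - G y) \<le> norm (x - y) + \<mu> * norm (x - G x)\<close>
  of Garcia-Falset's condition (E), with \<open>\<mu> = 1\<close> for \<open>T\<close> and \<open>\<mu> = 4\<close> for \<open>S\<close>. It carries all that the
  proof needs to know about a mapping: taking \<open>x\<close> to be a fixed point shows that \<open>G\<close> is
  quasi-nonexpansive, so that its fixed points form a closed convex set, and letting \<open>x\<close> run through
  approximate fixed points gives a demiclosedness principle. Let \<open>F\<close> be the set of fixed points named
  in the case at hand (of \<open>T\<close>, of \<open>S\<close>, or common ones) and \<open>p\<close> the point of \<open>F\<close> nearest to \<open>u\<close>; the
  sequence converges to this \<open>p\<close>.

  Write \<open>y\<^sub>n\<close> for the bracket in the recursion. Strict convexity of the squared norm gives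
  \<open>(norm (y\<^sub>n - p))\<^sup>2 \<le> (norm (x\<^sub>n - p))\<^sup>2 - r\<^sub>n + \<epsilon>\<^sub>n\<close>, where \<open>r\<^sub>n \<ge> 0\<close> measures how far \<open>x\<^sub>n\<close> is from being
  fixed and \<open>\<epsilon>\<^sub>n\<close> is summable: it accounts for the map of vanishing weight, and is zero when both maps
  are kept. Hence \<open>s\<^sub>n = (norm (x\<^sub>n - p))\<^sup>2\<close> satisfies \<open>s\<^sub>n\<^sub>+\<^sub>1 \<le> (1 - \<alpha>\<^sub>n) * s\<^sub>n + \<alpha>\<^sub>n * t\<^sub>n + \<epsilon>\<^sub>n\<close> with
  \<open>t\<^sub>n = 2 * inner (u - p) (x\<^sub>n\<^sub>+\<^sub>1 - p) - (1 - \<alpha>\<^sub>n) * r\<^sub>n / \<alpha>\<^sub>n\<close>, and \<open>s\<^sub>n \<longlonglongrightarrow> 0\<close> follows from the divergence of the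
  sum of the \<open>\<alpha>\<^sub>n\<close> as soon as the upper limit of \<open>t\<^sub>n\<close> is at most \<open>0\<close>
  (\<open>tendsto_zero_of_contractive_recursion\<close>). Keeping \<open>r\<^sub>n\<close> inside \<open>t\<^sub>n\<close> is what makes this work: along
  indices with \<open>t\<^sub>n \<ge> \<tau> > 0\<close> the quotient \<open>r\<^sub>n / \<alpha>\<^sub>n\<close> stays bounded, so \<open>r\<^sub>n \<longlonglongrightarrow> 0\<close>, the \<open>x\<^sub>n\<close> become
  approximate fixed points, and \<open>x\<^sub>n\<^sub>+\<^sub>1 - x\<^sub>n \<longlonglongrightarrow> 0\<close> (\<open>halpern_convergence\<close>).

  It remains to exclude that bounded approximate fixed points satisfy \<open>inner (u - p) (x\<^sub>n - p) \<ge> \<tau>\<close>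
  infinitely often (\<open>inner_nearest_point_eventually_less\<close>). Instead of a weak cluster point one can use
  the asymptotic center \<open>z\<close> of the offending indices, the unique minimizer of the upper limit of
  \<open>norm (x\<^sub>n - z)\<close>. Projections do not increase distances, so by uniqueness \<open>z\<close> lies in every closed
  convex set containing the \<open>x\<^sub>n\<close>, in particular in the half-space \<open>inner (u - p) (z - p) \<ge> \<tau>\<close>. By
  condition (E) the point \<open>G z\<close> is an equally good minimizer, so \<open>G z = z\<close> and \<open>z \<in> F\<close>. This contradicts
  the variational inequality for the nearest point \<open>p\<close>.
\<close>

section \<open>Asymptotic centers in Hilbert space\<close>

text \<open>
  For a bounded family and a proper filter this is the upper limit of \<open>norm (x n - z)\<close> along \<open>F\<close>. Filters take the place of
  subsequences: restricting to an infinite set of indices is passing to a smaller filter.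
\<close>

definition asym_radius :: "'i filter \<Rightarrow> ('i \<Rightarrow> 'a::real_normed_vector) \<Rightarrow> 'a \<Rightarrow> real" where
  "asym_radius F x z = Inf {c. \<forall>\<^sub>F n in F. norm (x n - z) \<le> c}"

lemma asym_radius_bounded_below:
  assumes "F \<noteq> bot"
  shows "bdd_below {c. \<forall>\<^sub>F n in F. norm (x n - z) \<le> c}"
proof (rule bdd_belowI[of _ 0])
  fix c assume "c \<in> {c. \<forall>\<^sub>F n in F. norm (x n - z) \<le> c}"
  then obtain n where "norm (x n - z) \<le> c"
    using assms eventually_happens by blast
  then show "0 \<le> c"
    by (meson norm_ge_zero order_trans)
qed

lemma asym_radius_le:
  assumes "F \<noteq> bot" "\<forall>\<^sub>F n in F. norm (x n - z) \<le> c"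
  shows "asym_radius F x z \<le> c"
  unfolding asym_radius_def
  using assms by (intro cInf_lower asym_radius_bounded_below) auto

lemma eventually_norm_diff_bounded:
  assumes "Bfun x F"
  shows "\<exists>c. \<forall>\<^sub>F n in F. norm (x n - z) \<le> c"
proof -
  obtain K where "\<forall>\<^sub>F n in F. norm (x n) \<le> K"
    using assms unfolding Bfun_def by blast
  then have "\<forall>\<^sub>F n in F. norm (x n - z) \<le> K + norm z"
    by eventually_elim (rule order_trans[OF norm_triangle_ineq4], simp)
  then show ?thesis by blast
qed

lemma eventually_le_asym_radius:
  assumes "Bfun x F" "asym_radius F x z < c"
  shows "\<forall>\<^sub>F n in F. norm (x n - z) \<le> c"
proof -
  have "{c. \<forall>\<^sub>F n in F. norm (x n - z) \<le> c} \<noteq> {}"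
    using eventually_norm_diff_bounded[OF assms(1)] by blast
  then obtain d where d: "\<forall>\<^sub>F n in F. norm (x n - z) \<le> d" "d < c"
    using cInf_lessD[OF _ assms(2)[unfolded asym_radius_def]] by blast
  from d(1) show ?thesis
    by eventually_elim (use d(2) in simp)
qed

lemma asym_radius_nonneg:
  assumes "F \<noteq> bot" "Bfun x F"
  shows "0 \<le> asym_radius F x z"
  unfolding asym_radius_def
proof (rule cInf_greatest)
  show "{c. \<forall>\<^sub>F n in F. norm (x n - z) \<le> c} \<noteq> {}"
    using eventually_norm_diff_bounded[OF assms(2)] by blast
  fix c assume "c \<in> {c. \<forall>\<^sub>F n in F. norm (x n - z) \<le> c}"
  then obtain n where "norm (x n - z) \<le> c"
    using assms eventually_happens by blast
  then show "0 \<le> c"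
    by (meson norm_ge_zero order_trans)
qed

lemma asym_radius_mono:
  assumes "F \<noteq> bot" "Bfun x F"
    and le: "\<forall>\<^sub>F n in F. norm (x n - w) \<le> norm (x n - v) + e n" and "(e \<longlongrightarrow> d) F"
  shows "asym_radius F x w \<le> asym_radius F x v + d"
proof (rule field_le_epsilon)
  fix h :: real assume "h > 0"
  have "\<forall>\<^sub>F n in F. norm (x n - v) \<le> asym_radius F x v + h / 2"
    using \<open>h > 0\<close> by (intro eventually_le_asym_radius assms) simp
  moreover have "\<forall>\<^sub>F n in F. e n < d + h / 2"
    using assms(4) \<open>h > 0\<close> by (intro order_tendstoD) auto
  ultimately have "\<forall>\<^sub>F n in F. norm (x n - w) \<le> asym_radius F x v + d + h"
    using le by eventually_elim simp
  then show "asym_radius F x w \<le> asym_radius F x v + d + h"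
    by (rule asym_radius_le[OF assms(1)])
qed

lemma midpoint_in_convex:
  assumes "convex K" "a \<in> K" "b \<in> K"
  shows "midpoint a b \<in> K"
  using convexD_alt[OF assms, of "1 / 2"] by (simp add: midpoint_def scaleR_add_right)

lemma parallelogram_law:
  fixes p q :: "'a::real_inner"
  shows "(norm (p + q))\<^sup>2 + (norm (p - q))\<^sup>2 = 2 * (norm p)\<^sup>2 + 2 * (norm q)\<^sup>2"
  by (simp add: power2_norm_eq_inner inner_add inner_diff inner_commute)

text \<open>
  The parallelogram law passes to the upper limit as an inequality. This uniform convexity is
  what makes minimizers of the asymptotic radius exist and be unique.
\<close>

lemma asym_radius_midpoint:
  fixes x :: "'i \<Rightarrow> 'a::real_inner"
  assumes "F \<noteq> bot" "Bfun x F"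
  shows "4 * (asym_radius F x (midpoint a b))\<^sup>2 + (norm (a - b))\<^sup>2
         \<le> 2 * (asym_radius F x a)\<^sup>2 + 2 * (asym_radius F x b)\<^sup>2"
    (is "4 * ?m\<^sup>2 + _ \<le> 2 * ?a\<^sup>2 + 2 * ?b\<^sup>2")
proof -
  have "4 * ?m\<^sup>2 + (norm (a - b))\<^sup>2 \<le> 2 * (?a + e)\<^sup>2 + 2 * (?b + e)\<^sup>2" if "e > 0" for e
  proof -
    let ?y = "(2 * (?a + e)\<^sup>2 + 2 * (?b + e)\<^sup>2 - (norm (a - b))\<^sup>2) / 4"
    have "\<forall>\<^sub>F n in F. norm (x n - a) \<le> ?a + e" "\<forall>\<^sub>F n in F. norm (x n - b) \<le> ?b + e"
      using that by (intro eventually_le_asym_radius assms; simp)+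
    then have "\<forall>\<^sub>F n in F. norm (x n - midpoint a b) \<le> sqrt ?y"
    proof eventually_elim
      case (elim n)
      have "x n - a + (x n - b) = 2 *\<^sub>R (x n - midpoint a b)"
        by (simp add: midpoint_def algebra_simps scaleR_2)
      then have "4 * (norm (x n - midpoint a b))\<^sup>2 + (norm (a - b))\<^sup>2
                 = 2 * (norm (x n - a))\<^sup>2 + 2 * (norm (x n - b))\<^sup>2"
        using parallelogram_law[of "x n - a" "x n - b"]
        by (simp add: power_mult_distrib norm_minus_commute)
      also have "\<dots> \<le> 2 * (?a + e)\<^sup>2 + 2 * (?b + e)\<^sup>2"
        using elim by (intro add_mono mult_left_mono power_mono) auto
      finally show ?case
        by (intro real_le_rsqrt) simp
    qed
    then have "?m \<le> sqrt ?y"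
      by (rule asym_radius_le[OF assms(1)])
    moreover have "?m \<ge> 0"
      by (rule asym_radius_nonneg[OF assms])
    ultimately have "?m\<^sup>2 \<le> ?y"
      by (metis order_trans power_mono real_sqrt_ge_0_iff real_sqrt_pow2)
    then show ?thesis by simp
  qed
  then have "\<forall>\<^sub>F e in at_right 0.
      4 * ?m\<^sup>2 + (norm (a - b))\<^sup>2 \<le> 2 * (?a + e)\<^sup>2 + 2 * (?b + e)\<^sup>2"
    by (auto simp: eventually_at_filter)
  moreover have "((\<lambda>e. 2 * (?a + e)\<^sup>2 + 2 * (?b + e)\<^sup>2)
      \<longlongrightarrow> 2 * (?a + 0)\<^sup>2 + 2 * (?b + 0)\<^sup>2) (at_right 0)"
    by (intro tendsto_intros)
  ultimately show ?thesis
    using tendsto_lowerbound[where F = "at_right (0::real)"] by fastforce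
qed

lemma asym_center_unique:
  fixes x :: "'i \<Rightarrow> 'a::real_inner"
  assumes "F \<noteq> bot" "Bfun x F" "convex K"
    and "z \<in> K" "\<And>w. w \<in> K \<Longrightarrow> asym_radius F x z \<le> asym_radius F x w"
    and "v \<in> K" "asym_radius F x v \<le> asym_radius F x z"
  shows "v = z"
proof -
  have "midpoint z v \<in> K"
    using assms by (intro midpoint_in_convex)
  then have "asym_radius F x z \<le> asym_radius F x (midpoint z v)"
    by (rule assms)
  then have "(asym_radius F x z)\<^sup>2 \<le> (asym_radius F x (midpoint z v))\<^sup>2"
    using asym_radius_nonneg[OF assms(1,2)] by (simp add: power_mono)
  moreover have "(asym_radius F x v)\<^sup>2 \<le> (asym_radius F x z)\<^sup>2"
    using asym_radius_nonneg[OF assms(1,2)] assms(7) by (simp add: power_mono)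
  ultimately have "(norm (z - v))\<^sup>2 \<le> 0"
    using asym_radius_midpoint[OF assms(1,2), of z v] by linarith
  then show ?thesis by simp
qed

text \<open>
  A minimizing sequence is Cauchy, because the midpoints of its members cannot fall below the
  infimum; the asymptotic radius is 1-Lipschitz, so the limit attains the infimum.
\<close>

lemma asym_center_exists:
  fixes x :: "'i \<Rightarrow> 'a::{real_inner, complete_space}"
  assumes F: "F \<noteq> bot" "Bfun x F" and K: "closed K" "convex K" "K \<noteq> {}"
  obtains z where "z \<in> K" "\<And>w. w \<in> K \<Longrightarrow> asym_radius F x z \<le> asym_radius F x w"
proof -
  let ?r = "asym_radius F x"
  define m where "m = Inf (?r ` K)"
  have bdd: "bdd_below (?r ` K)"
    using asym_radius_nonneg[OF F] by (auto intro!: bdd_belowI[of _ 0])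
  have m_le: "m \<le> ?r w" if "w \<in> K" for w
    unfolding m_def using that bdd by (intro cInf_lower) auto
  have "0 \<le> m"
    unfolding m_def using K asym_radius_nonneg[OF F] by (intro cInf_greatest) auto
  have "\<exists>w\<in>K. ?r w < m + inverse (real (Suc k))" for k
    using cInf_lessD[of "?r ` K" "m + inverse (real (Suc k))"] K
    unfolding m_def by auto
  then obtain w where w: "w k \<in> K" "?r (w k) < m + inverse (real (Suc k))" for k
    by metis
  have dist_w: "(norm (w j - w k))\<^sup>2 \<le> 4 * (m + inverse (real (Suc N)))\<^sup>2 - 4 * m\<^sup>2"
    if "j \<ge> N" "k \<ge> N" for j k N
  proof -
    have le: "(?r (w i))\<^sup>2 \<le> (m + inverse (real (Suc N)))\<^sup>2" if "i \<ge> N" for i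
    proof (rule power_mono)
      have "inverse (real (Suc i)) \<le> inverse (real (Suc N))"
        using that by (simp add: field_simps)
      then show "?r (w i) \<le> m + inverse (real (Suc N))"
        using w(2)[of i] by linarith
    qed (rule asym_radius_nonneg[OF F])
    have "midpoint (w j) (w k) \<in> K"
      using K w by (intro midpoint_in_convex)
    then have "m\<^sup>2 \<le> (?r (midpoint (w j) (w k)))\<^sup>2"
      using \<open>0 \<le> m\<close> m_le by (intro power_mono)
    then show ?thesis
      using asym_radius_midpoint[OF F, of "w j" "w k"] le[OF that(1)] le[OF that(2)] by linarith
  qed
  have "(\<lambda>N. 4 * (m + inverse (real (Suc N)))\<^sup>2 - 4 * m\<^sup>2) \<longlonglongrightarrow> 4 * (m + 0)\<^sup>2 - 4 * m\<^sup>2"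
    by (intro tendsto_intros LIMSEQ_inverse_real_of_nat)
  then have gap: "(\<lambda>N. 4 * (m + inverse (real (Suc N)))\<^sup>2 - 4 * m\<^sup>2) \<longlonglongrightarrow> 0"
    by simp
  have "Cauchy w"
  proof (rule CauchyI)
    fix e :: real assume "e > 0"
    then have "\<forall>\<^sub>F N in sequentially. 4 * (m + inverse (real (Suc N)))\<^sup>2 - 4 * m\<^sup>2 < e\<^sup>2"
      using gap by (intro order_tendstoD) auto
    then obtain N where gapN: "4 * (m + inverse (real (Suc N)))\<^sup>2 - 4 * m\<^sup>2 < e\<^sup>2"
      using eventually_happens by fastforce
    have "norm (w j - w k) < e" if "j \<ge> N" "k \<ge> N" for j k
      by (rule power2_less_imp_less) (use dist_w[OF that] gapN \<open>e > 0\<close> in auto)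
    then show "\<exists>N. \<forall>j\<ge>N. \<forall>k\<ge>N. norm (w j - w k) < e" by blast
  qed
  then obtain z where z: "w \<longlonglongrightarrow> z"
    using Cauchy_convergent convergent_def by blast
  have "z \<in> K"
    using closed_sequentially[OF K(1)] w(1) z by blast
  have "?r z \<le> m + inverse (real (Suc k)) + norm (w k - z)" for k
  proof -
    have "?r z \<le> ?r (w k) + norm (w k - z)"
      by (rule asym_radius_mono[OF F always_eventually tendsto_const])
        (use norm_triangle_ineq[of "x _ - w k" "w k - z"] in simp)
    then show ?thesis using w(2)[of k] by linarith
  qed
  moreover have "(\<lambda>k. m + inverse (real (Suc k)) + norm (w k - z)) \<longlonglongrightarrow> m + 0 + norm (z - z)"
    by (intro tendsto_intros LIMSEQ_inverse_real_of_nat z)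
  ultimately have "?r z \<le> m"
    using LIMSEQ_le_const[of _ "m + 0 + norm (z - z)" "?r z"] by auto
  then show thesis
    using that[OF \<open>z \<in> K\<close>] m_le by force
qed

lemma asym_radius_const:
  "asym_radius sequentially (\<lambda>_. u) z = norm (u - z)"
  unfolding asym_radius_def by (simp add: atLeast_def[symmetric])

text \<open>
  The nearest point to \<open>u\<close> is the asymptotic center of the constant sequence \<open>u\<close>; minimality along
  segments gives the variational inequality.
\<close>

lemma nearest_point_exists:
  fixes u :: "'a::{real_inner, complete_space}"
  assumes "closed K" "convex K" "K \<noteq> {}"
  obtains p where "p \<in> K" "\<And>z. z \<in> K \<Longrightarrow> inner (u - p) (z - p) \<le> 0"
proof -
  obtain p where p: "p \<in> K" "\<And>z. z \<in> K \<Longrightarrow> norm (u - p) \<le> norm (u - z)"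
    using asym_center_exists[OF sequentially_bot Bfun_const assms, of u]
    unfolding asym_radius_const by blast
  have "inner (u - p) (z - p) \<le> 0" if "z \<in> K" for z
    using any_closest_point_dot[OF assms(2,1) p(1) that] p(2) by (simp add: dist_norm)
  with p(1) show thesis by (rule that)
qed

text \<open>
  Replacing \<open>z\<close> by its nearest point in \<open>K\<close> increases the distance to no point of \<open>K\<close>, so the
  radius does not grow, and uniqueness of the center forces the two points to agree.
\<close>

lemma asym_center_in_closed_convex:
  fixes x :: "'i \<Rightarrow> 'a::{real_inner, complete_space}"
  assumes F: "F \<noteq> bot" "Bfun x F" and min: "\<And>w. asym_radius F x z \<le> asym_radius F x w"
    and K: "closed K" "convex K" and ev: "\<forall>\<^sub>F n in F. x n \<in> K"
  shows "z \<in> K"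
proof -
  have "K \<noteq> {}"
    using eventually_happens[OF ev] F by blast
  then obtain v where v: "v \<in> K" "\<And>y. y \<in> K \<Longrightarrow> inner (z - v) (y - v) \<le> 0"
    using nearest_point_exists[OF K] by blast
  have "norm (y - v) \<le> norm (y - z)" if "y \<in> K" for y
  proof (rule power2_le_imp_le)
    have "(norm (y - z))\<^sup>2 = (norm (y - v))\<^sup>2 - 2 * inner (z - v) (y - v) + (norm (z - v))\<^sup>2"
      by (simp add: power2_norm_eq_inner inner_diff inner_commute)
    then show "(norm (y - v))\<^sup>2 \<le> (norm (y - z))\<^sup>2"
      using v(2)[OF that] zero_le_power2[of "norm (z - v)"] by linarith
  qed simp
  then have "\<forall>\<^sub>F n in F. norm (x n - v) \<le> norm (x n - z) + 0"
    using ev by (auto elim: eventually_mono)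
  then have "asym_radius F x v \<le> asym_radius F x z"
    using asym_radius_mono[OF F _ tendsto_const] by fastforce
  then have "v = z"
    using asym_center_unique[OF F, of UNIV z v] min by simp
  with v show ?thesis by simp
qed

section \<open>Condition (E) and fixed points\<close>

definition condition_E :: "real \<Rightarrow> 'a::real_normed_vector set \<Rightarrow> ('a \<Rightarrow> 'a) \<Rightarrow> bool" where
  "condition_E \<mu> C G \<longleftrightarrow>
     (\<forall>x\<in>C. \<forall>y\<in>C. norm (x - G y) \<le> norm (x - y) + \<mu> * norm (x - G x))"

lemma nonexpansive_condition_E:
  assumes "nonexpansive_on C T"
  shows "condition_E 1 C T"
  unfolding condition_E_def
proof (intro ballI)
  fix x y assume "x \<in> C" "y \<in> C"
  then have "norm (T x - T y) \<le> norm (x - y)"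
    using assms by (simp add: nonexpansive_on_def)
  then show "norm (x - T y) \<le> norm (x - y) + 1 * norm (x - T x)"
    using norm_triangle_ineq[of "x - T x" "T x - T y"] by simp
qed

text \<open>
  With \<open>a = norm (x - S y)\<close>, \<open>b = norm (x - y)\<close> and \<open>d = norm (x - S x)\<close>, the triangle inequality turns
  the nonspreading inequality into \<open>2 * (a - d)\<^sup>2 \<le> (b + d)\<^sup>2 + a\<^sup>2\<close>. Completing the square in \<open>a\<close> bounds
  \<open>(a - 2 * d)\<^sup>2\<close> by \<open>(b + 2 * d)\<^sup>2\<close>, which is where the constant \<open>4 = 2 + 2\<close> comes from.
\<close>

lemma nonspreading_condition_E:
  assumes "nonspreading_on C S"
  shows "condition_E 4 C S"
  unfolding condition_E_def
proof (intro ballI)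
  fix x y assume xy: "x \<in> C" "y \<in> C"
  define a b d where "a = norm (x - S y)" and "b = norm (x - y)" and "d = norm (x - S x)"
  have nonneg: "0 \<le> b" "0 \<le> d"
    by (simp_all add: b_def d_def)
  have "\<bar>a - d\<bar> \<le> norm (S x - S y)"
    using norm_triangle_ineq3[of "x - S y" "x - S x"] by (simp add: a_def d_def)
  then have "(a - d)\<^sup>2 \<le> (norm (S x - S y))\<^sup>2"
    by (simp add: abs_le_square_iff[symmetric])
  moreover have "norm (S x - y) \<le> b + d"
    using norm_triangle_ineq[of "S x - x" "x - y"] by (simp add: b_def d_def norm_minus_commute)
  then have "(norm (S x - y))\<^sup>2 \<le> (b + d)\<^sup>2"
    by (simp add: power_mono)
  moreover have "2 * (norm (S x - S y))\<^sup>2 \<le> (norm (S x - y))\<^sup>2 + a\<^sup>2"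
    using assms xy by (simp add: nonspreading_on_def a_def)
  ultimately have "2 * (a - d)\<^sup>2 \<le> (b + d)\<^sup>2 + a\<^sup>2"
    by linarith
  then have "(a - 2 * d)\<^sup>2 \<le> b\<^sup>2 + 2 * b * d + 3 * d\<^sup>2"
    by (simp add: power2_eq_square algebra_simps)
  also have "\<dots> \<le> (b + 2 * d)\<^sup>2"
    using nonneg by (simp add: power2_eq_square algebra_simps)
  finally have "a - 2 * d \<le> b + 2 * d"
    by (rule power2_le_imp_le) (use nonneg in simp)
  then show "norm (x - S y) \<le> norm (x - y) + 4 * norm (x - S x)"
    by (simp add: a_def b_def d_def)
qed

lemma condition_E_quasi_nonexpansive:
  assumes "condition_E \<mu> C G" "p \<in> Fix C G" "x \<in> C"
  shows "norm (G x - p) \<le> norm (x - p)"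
  using assms unfolding condition_E_def Fix_def by (force simp: norm_minus_commute)

text \<open>
  The exact form of the strong convexity of the squared norm; it yields both the convexity of the
  fixed point set and the decrease achieved by averaging.
\<close>

lemma norm_convex_combination:
  fixes a b w :: "'a::real_inner"
  shows "(norm (w - ((1 - t) *\<^sub>R a + t *\<^sub>R b)))\<^sup>2
         = (1 - t) * (norm (w - a))\<^sup>2 + t * (norm (w - b))\<^sup>2 - t * (1 - t) * (norm (a - b))\<^sup>2"
  unfolding power2_norm_eq_inner
  by (simp add: inner_add inner_diff inner_commute algebra_simps)

text \<open>
  For a point \<open>z\<close> of the segment between two fixed points, \<open>G z\<close> is at most as far from either end as
  \<open>z\<close> is, and in an inner product space only \<open>z\<close> itself has this property.
\<close>

lemma convex_Fix:
  fixes C :: "'a::real_inner set"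
  assumes E: "condition_E \<mu> C G" and "convex C"
  shows "convex (Fix C G)"
  unfolding convex_alt
proof (intro ballI allI impI, elim conjE)
  fix a b and t :: real
  assume ab: "a \<in> Fix C G" "b \<in> Fix C G" and t: "0 \<le> t" "t \<le> 1"
  define z where "z = (1 - t) *\<^sub>R a + t *\<^sub>R b"
  have z: "z \<in> C"
    using ab t \<open>convex C\<close> by (simp add: z_def Fix_def convex_alt)
  have "(norm (G z - z))\<^sup>2
        = (1 - t) * (norm (G z - a))\<^sup>2 + t * (norm (G z - b))\<^sup>2 - t * (1 - t) * (norm (a - b))\<^sup>2"
    unfolding z_def by (rule norm_convex_combination)
  also have "\<dots> \<le> (1 - t) * (norm (z - a))\<^sup>2 + t * (norm (z - b))\<^sup>2 - t * (1 - t) * (norm (a - b))\<^sup>2"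
    using t condition_E_quasi_nonexpansive[OF E _ z] ab
    by (intro diff_right_mono add_mono mult_left_mono power_mono) auto
  also have "\<dots> = (norm (z - z))\<^sup>2"
    unfolding z_def by (rule norm_convex_combination[symmetric])
  finally show "(1 - t) *\<^sub>R a + t *\<^sub>R b \<in> Fix C G"
    using z by (simp add: Fix_def z_def)
qed

lemma closed_Fix:
  assumes E: "condition_E \<mu> C G" and "closed C"
  shows "closed (Fix C G)"
  unfolding closed_sequential_limits
proof (intro allI impI, elim conjE)
  fix y l assume y: "\<forall>n. y n \<in> Fix C G" and l: "y \<longlonglongrightarrow> l"
  have "l \<in> C"
    using closed_sequentially[OF \<open>closed C\<close> _ l] y by (simp add: Fix_def)
  then have "norm (G l - y n) \<le> norm (l - y n)" for n
    using condition_E_quasi_nonexpansive[OF E] y by blast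
  moreover have "(\<lambda>n. norm (l - y n)) \<longlonglongrightarrow> norm (l - l)" "(\<lambda>n. norm (G l - y n)) \<longlonglongrightarrow> norm (G l - l)"
    by (intro tendsto_intros l)+
  ultimately have "norm (G l - l) \<le> norm (l - l)"
    using LIMSEQ_le by blast
  then show "l \<in> Fix C G"
    using \<open>l \<in> C\<close> by (simp add: Fix_def)
qed

text \<open>
  A substitute for demiclosedness of \<open>I - G\<close> at zero: condition (E) bounds the radius at \<open>G z\<close> by the
  radius at \<open>z\<close>, the error term vanishing in the limit, and the center is unique.
\<close>

lemma asym_center_fixed:
  fixes x :: "'i \<Rightarrow> 'a::{real_inner, complete_space}"
  assumes F: "F \<noteq> bot" "Bfun x F" and min: "\<And>w. asym_radius F x z \<le> asym_radius F x w"
    and E: "condition_E \<mu> C G" and C: "closed C" "convex C" and ev: "\<forall>\<^sub>F n in F. x n \<in> C"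
    and approx: "((\<lambda>n. x n - G (x n)) \<longlongrightarrow> 0) F"
  shows "z \<in> Fix C G"
proof -
  have z: "z \<in> C"
    by (rule asym_center_in_closed_convex[OF F min C ev])
  have "\<forall>\<^sub>F n in F. norm (x n - G z) \<le> norm (x n - z) + \<mu> * norm (x n - G (x n))"
    using ev by eventually_elim (use E z in \<open>simp add: condition_E_def\<close>)
  moreover have "((\<lambda>n. \<mu> * norm (x n - G (x n))) \<longlongrightarrow> \<mu> * norm (0::'a)) F"
    by (intro tendsto_intros approx)
  ultimately have "asym_radius F x (G z) \<le> asym_radius F x z"
    using asym_radius_mono[OF F] by fastforce
  then have "G z = z"
    using asym_center_unique[OF F, of UNIV z "G z"] min by simp
  with z show ?thesis by (simp add: Fix_def)
qed

text \<open>
  If the claim failed, the asymptotic center of the exceptional part of the sequence would be a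
  common fixed point of \<open>\<G>\<close> on the wrong side of the hyperplane through \<open>p\<close> that bounds the
  common fixed point set.
\<close>

lemma inner_nearest_point_eventually_less:
  fixes x :: "'i \<Rightarrow> 'a::{real_inner, complete_space}"
  assumes B: "Bfun x F" and C: "closed C" "convex C" and ev: "\<forall>\<^sub>F n in F. x n \<in> C"
    and E: "\<And>G. G \<in> \<G> \<Longrightarrow> \<exists>\<mu>. condition_E \<mu> C G"
    and approx: "\<And>G. G \<in> \<G> \<Longrightarrow> ((\<lambda>n. x n - G (x n)) \<longlongrightarrow> 0) F"
    and p: "\<And>z. z \<in> (\<Inter>G\<in>\<G>. Fix C G) \<Longrightarrow> inner (u - p) (z - p) \<le> 0" and "\<tau> > 0"
  shows "\<forall>\<^sub>F n in F. inner (u - p) (x n - p) < \<tau>"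
proof (rule ccontr)
  assume not_ev: "\<not> ?thesis"
  define K where "K = {y. inner (u - p) y \<ge> \<tau> + inner (u - p) p}"
  \<comment> \<open>The exceptional indices occur frequently, so restricting \<open>F\<close> to them leaves a proper filter.\<close>
  define F' where "F' = inf F (principal {n. x n \<in> K})"
  have "F' \<le> F"
    by (simp add: F'_def)
  have "F' \<noteq> bot"
  proof
    assume "F' = bot"
    then have "\<forall>\<^sub>F n in F. x n \<notin> K"
      by (simp add: F'_def trivial_limit_def eventually_inf_principal)
    then have "\<forall>\<^sub>F n in F. inner (u - p) (x n - p) < \<tau>"
      by (simp add: K_def inner_diff_right not_le algebra_simps)
    with not_ev show False ..
  qed
  moreover have "Bfun x F'"
    using B \<open>F' \<le> F\<close> unfolding Bfun_def by (meson filter_leD)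
  ultimately have F': "F' \<noteq> bot" "Bfun x F'" .
  obtain z where z: "\<And>w. asym_radius F' x z \<le> asym_radius F' x w"
    using asym_center_exists[OF F', of UNIV] by auto
  have "z \<in> K"
  proof (rule asym_center_in_closed_convex[OF F' z])
    show "closed K" "convex K"
      unfolding K_def by (rule closed_halfspace_ge convex_halfspace_ge)+
    show "\<forall>\<^sub>F n in F'. x n \<in> K"
      by (simp add: F'_def eventually_inf_principal)
  qed
  moreover have "z \<in> Fix C G" if "G \<in> \<G>" for G
  proof -
    obtain \<mu> where "condition_E \<mu> C G"
      using E[OF \<open>G \<in> \<G>\<close>] by blast
    then show ?thesis
      by (rule asym_center_fixed[OF F' z _ C])
        (use ev approx[OF \<open>G \<in> \<G>\<close>] \<open>F' \<le> F\<close> in \<open>auto intro: filter_leD tendsto_mono\<close>)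
  qed
  then have "inner (u - p) (z - p) \<le> 0"
    by (intro p) blast
  ultimately show False
    using \<open>\<tau> > 0\<close> by (simp add: K_def inner_diff_right)
qed

section \<open>Convergence of perturbed Halpern iterations\<close>

text \<open>
  Once \<open>t n\<close> and the tail of the sum of \<open>\<epsilon>\<close> are below \<open>\<tau>\<close>, unrolling the recursion leaves at most \<open>2 * \<tau>\<close> plus the
  initial value damped by the product of the \<open>1 - \<alpha> i\<close>, and divergence of the sum of \<open>\<alpha>\<close> drives this
  product to zero.
\<close>

lemma tendsto_zero_of_contractive_recursion:
  fixes a \<alpha> t \<epsilon> :: "nat \<Rightarrow> real"
  assumes a: "\<And>n. 0 \<le> a n" and \<alpha>: "\<And>n. n \<ge> 1 \<Longrightarrow> \<alpha> n \<in> {0<..<1}"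
    and div: "filterlim (\<lambda>N. \<Sum>n=1..N. \<alpha> n) at_top sequentially"
    and \<epsilon>: "summable \<epsilon>" "\<And>n. n \<ge> 1 \<Longrightarrow> 0 \<le> \<epsilon> n"
    and rec: "\<And>n. n \<ge> 1 \<Longrightarrow> a (n + 1) \<le> (1 - \<alpha> n) * a n + \<alpha> n * t n + \<epsilon> n"
    and t: "\<And>\<tau>. \<tau> > 0 \<Longrightarrow> \<forall>\<^sub>F n in sequentially. t n < \<tau>"
  shows "a \<longlonglongrightarrow> 0"
proof (rule order_tendstoI)
  fix e :: real assume "e < 0"
  then show "\<forall>\<^sub>F n in sequentially. e < a n"
    using a by (intro always_eventually allI) (meson less_le_trans)
next
  fix e :: real assume "0 < e"
  define \<tau> where "\<tau> = e / 3"
  have "\<tau> > 0"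
    using \<open>0 < e\<close> by (simp add: \<tau>_def)
  obtain m1 where m1: "\<And>n. n \<ge> m1 \<Longrightarrow> t n < \<tau>"
    using t[OF \<open>\<tau> > 0\<close>] by (auto simp: eventually_sequentially)
  obtain m2 where m2: "\<And>m n. m \<ge> m2 \<Longrightarrow> norm (sum \<epsilon> {m..<n}) < \<tau>"
    using \<epsilon>(1) \<open>\<tau> > 0\<close> unfolding summable_Cauchy by blast
  define m where "m = max 1 (max m1 m2)"
  have m: "m \<ge> 1" "m \<ge> m1" "m \<ge> m2"
    by (simp_all add: m_def)
  let ?P = "\<lambda>n. \<Prod>i=m..<n. 1 - \<alpha> i"
  have bound: "a n \<le> \<tau> + ?P n * a m + sum \<epsilon> {m..<n}" if "n \<ge> m" for n
    using that
  proof (induction n rule: dec_induct)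
    case base
    then show ?case using \<open>\<tau> > 0\<close> by simp
  next
    case (step n)
    have n: "n \<ge> 1" "n \<ge> m1"
      using step m by auto
    have nonneg: "0 \<le> sum \<epsilon> {m..<n}"
      using m \<epsilon>(2) by (intro sum_nonneg) simp
    have "a (Suc n) \<le> (1 - \<alpha> n) * a n + \<alpha> n * t n + \<epsilon> n"
      using rec[OF n(1)] by simp
    also have "\<dots> \<le> (1 - \<alpha> n) * (\<tau> + ?P n * a m + sum \<epsilon> {m..<n}) + \<alpha> n * \<tau> + \<epsilon> n"
      using \<alpha>[OF n(1)] m1[OF n(2)] step.IH by (intro add_mono mult_left_mono) auto
    also have "\<dots> = \<tau> + ?P n * (1 - \<alpha> n) * a m + (1 - \<alpha> n) * sum \<epsilon> {m..<n} + \<epsilon> n"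
      by (simp add: algebra_simps)
    also have "\<dots> \<le> \<tau> + ?P n * (1 - \<alpha> n) * a m + 1 * sum \<epsilon> {m..<n} + \<epsilon> n"
      using \<alpha>[OF n(1)] nonneg by (intro add_mono mult_right_mono order_refl) auto
    also have "\<dots> = \<tau> + ?P (Suc n) * a m + sum \<epsilon> {m..<Suc n}"
      using step.hyps by simp
    finally show ?case .
  qed
  have P_le: "?P (Suc n) \<le> exp (sum \<alpha> {1..<m}) * exp (- (\<Sum>i=1..n. \<alpha> i))" if "Suc n \<ge> m" for n
  proof -
    have "?P (Suc n) \<le> (\<Prod>i=m..<Suc n. exp (- \<alpha> i))"
    proof (rule prod_mono)
      fix i assume "i \<in> {m..<Suc n}"
      then have "\<alpha> i < 1"
        using \<alpha>[of i] m by simp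
      then show "0 \<le> 1 - \<alpha> i \<and> 1 - \<alpha> i \<le> exp (- \<alpha> i)"
        using exp_ge_add_one_self[of "- \<alpha> i"] by simp
    qed
    also have "\<dots> = exp (- sum \<alpha> {m..<Suc n})"
      by (simp only: exp_sum[symmetric] finite_atLeastLessThan sum_negf)
    also have "sum \<alpha> {m..<Suc n} = (\<Sum>i=1..n. \<alpha> i) - sum \<alpha> {1..<m}"
      using sum.atLeastLessThan_concat[OF m(1) that, of \<alpha>] by (simp add: atLeastLessThanSuc_atLeastAtMost)
    finally show ?thesis
      by (simp add: exp_add[symmetric])
  qed
  have "((\<lambda>n. exp (- (\<Sum>i=1..n. \<alpha> i))) \<longlongrightarrow> 0) sequentially"
    by (rule filterlim_compose[OF exp_at_bot])
      (simp only: filterlim_uminus_at_bot_at_top[THEN filterlim_compose, OF div])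
  then have "((\<lambda>n. exp (sum \<alpha> {1..<m}) * exp (- (\<Sum>i=1..n. \<alpha> i)) * a m) \<longlongrightarrow>
      exp (sum \<alpha> {1..<m}) * 0 * a m) sequentially"
    by (intro tendsto_intros)
  then have "\<forall>\<^sub>F n in sequentially. exp (sum \<alpha> {1..<m}) * exp (- (\<Sum>i=1..n. \<alpha> i)) * a m < \<tau>"
    using \<open>\<tau> > 0\<close> by (intro order_tendstoD) auto
  moreover have "\<forall>\<^sub>F n in sequentially. n \<ge> m"
    by (rule eventually_ge_at_top)
  ultimately have "\<forall>\<^sub>F n in sequentially. a (Suc n) < e"
  proof eventually_elim
    case (elim n)
    have "a (Suc n) \<le> \<tau> + ?P (Suc n) * a m + sum \<epsilon> {m..<Suc n}"
      using elim by (intro bound) simp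
    moreover have "?P (Suc n) * a m \<le> exp (sum \<alpha> {1..<m}) * exp (- (\<Sum>i=1..n. \<alpha> i)) * a m"
      using elim by (intro mult_right_mono P_le a) simp
    moreover have "sum \<epsilon> {m..<Suc n} < \<tau>"
      using m2[OF m(3), of "Suc n"] by simp
    ultimately show ?case
      using elim by (simp add: \<tau>_def)
  qed
  then show "\<forall>\<^sub>F n in sequentially. a n < e"
    by (rule eventually_sequentially_Suc[THEN iffD1])
qed

text \<open>
  The recursion \<open>x (n + 1) = \<alpha> n *\<^sub>R u + (1 - \<alpha> n) *\<^sub>R y n\<close> anchors the iteration at \<open>u\<close>, and \<open>r n\<close> is,
  up to \<open>\<epsilon> n\<close>, a guaranteed decrease of the squared distance to \<open>p\<close> from \<open>x n\<close> to \<open>y n\<close>. The last two hypotheses are required only along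
  filters on which \<open>r\<close> vanishes, where the iterates are approximate fixed points.
\<close>

lemma halpern_convergence:
  fixes x y :: "nat \<Rightarrow> 'a::real_inner" and \<alpha> r \<epsilon> :: "nat \<Rightarrow> real"
  assumes \<alpha>: "\<And>n. n \<ge> 1 \<Longrightarrow> \<alpha> n \<in> {0<..<1}" "\<alpha> \<longlonglongrightarrow> 0"
    and div: "filterlim (\<lambda>N. \<Sum>n=1..N. \<alpha> n) at_top sequentially"
    and rec: "\<And>n. n \<ge> 1 \<Longrightarrow> x (n + 1) = \<alpha> n *\<^sub>R u + (1 - \<alpha> n) *\<^sub>R y n"
    and bounded: "\<And>n. n \<ge> 1 \<Longrightarrow> norm (x n) \<le> R"
    and energy: "\<And>n. n \<ge> 1 \<Longrightarrow> (norm (y n - p))\<^sup>2 \<le> (norm (x n - p))\<^sup>2 - r n + \<epsilon> n"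
    and r: "\<And>n. n \<ge> 1 \<Longrightarrow> 0 \<le> r n"
    and \<epsilon>: "summable \<epsilon>" "\<And>n. n \<ge> 1 \<Longrightarrow> 0 \<le> \<epsilon> n"
    and regular: "\<And>F. F \<le> sequentially \<Longrightarrow> (r \<longlongrightarrow> 0) F \<Longrightarrow> ((\<lambda>n. y n - x n) \<longlongrightarrow> 0) F"
    and variational: "\<And>F \<tau>. F \<le> sequentially \<Longrightarrow> (r \<longlongrightarrow> 0) F \<Longrightarrow> \<tau> > 0
                        \<Longrightarrow> \<forall>\<^sub>F n in F. inner (u - p) (x n - p) < \<tau>"
  shows "x \<longlonglongrightarrow> p"
proof -
  define t where "t n = 2 * inner (u - p) (x (n + 1) - p) - (1 - \<alpha> n) * r n / \<alpha> n" for n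
  have "(\<lambda>n. (norm (x n - p))\<^sup>2) \<longlonglongrightarrow> 0"
  proof (rule tendsto_zero_of_contractive_recursion[OF _ \<alpha>(1) div \<epsilon>])
    fix n :: nat assume n: "n \<ge> 1"
    have pos: "0 < \<alpha> n" "\<alpha> n < 1"
      using \<alpha>(1)[OF n] by auto
    define v w where "v = u - p" and "w = y n - p"
    have step: "x (n + 1) - p = \<alpha> n *\<^sub>R v + (1 - \<alpha> n) *\<^sub>R w"
      using rec[OF n] by (simp add: v_def w_def algebra_simps)
    have "(norm (x (n + 1) - p))\<^sup>2
          = (1 - \<alpha> n)\<^sup>2 * (norm w)\<^sup>2 + 2 * \<alpha> n * inner v (x (n + 1) - p) - (\<alpha> n)\<^sup>2 * (norm v)\<^sup>2"
      unfolding step power2_norm_eq_inner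
      by (simp add: inner_add inner_commute power2_eq_square algebra_simps)
    also have "\<dots> \<le> (1 - \<alpha> n)\<^sup>2 * (norm w)\<^sup>2 + 2 * \<alpha> n * inner v (x (n + 1) - p)"
      by simp
    also have "(1 - \<alpha> n)\<^sup>2 * (norm w)\<^sup>2 \<le> (1 - \<alpha> n) * (norm w)\<^sup>2"
      using pos by (intro mult_right_mono) (auto simp: power2_eq_square mult_left_le)
    also have "(1 - \<alpha> n) * (norm w)\<^sup>2 \<le> (1 - \<alpha> n) * ((norm (x n - p))\<^sup>2 - r n + \<epsilon> n)"
      using pos energy[OF n] by (intro mult_left_mono) (auto simp: w_def)
    also have "\<dots> \<le> (1 - \<alpha> n) * (norm (x n - p))\<^sup>2 - (1 - \<alpha> n) * r n + \<epsilon> n"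
      using pos \<epsilon>(2)[OF n] by (simp add: algebra_simps)
    finally have "(norm (x (n + 1) - p))\<^sup>2 \<le> (1 - \<alpha> n) * (norm (x n - p))\<^sup>2 - (1 - \<alpha> n) * r n + \<epsilon> n
        + 2 * \<alpha> n * inner v (x (n + 1) - p)"
      by simp
    moreover have "\<alpha> n * t n = 2 * \<alpha> n * inner v (x (n + 1) - p) - (1 - \<alpha> n) * r n"
      using pos by (simp add: t_def v_def field_simps)
    ultimately show "(norm (x (n + 1) - p))\<^sup>2 \<le> (1 - \<alpha> n) * (norm (x n - p))\<^sup>2 + \<alpha> n * t n + \<epsilon> n"
      by linarith
  next
    fix \<tau> :: real assume "\<tau> > 0"
    show "\<forall>\<^sub>F n in sequentially. t n < \<tau>"
    proof (rule ccontr)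
      assume not_ev: "\<not> ?thesis"
      \<comment> \<open>On the indices with \<open>\<tau> \<le> t n\<close> the nonpositive term of \<open>t n\<close> is bounded, so \<open>r\<close> is at most a
        multiple of \<open>\<alpha>\<close> and tends to zero there.\<close>
      define F where "F = inf sequentially (principal {n. \<tau> \<le> t n})"
      have F: "F \<le> sequentially"
        by (simp add: F_def)
      have large: "\<forall>\<^sub>F n in F. \<tau> \<le> t n"
        by (simp add: F_def eventually_inf_principal)
      have \<alpha>F: "(\<alpha> \<longlongrightarrow> 0) F"
        by (rule tendsto_mono[OF F \<alpha>(2)])
      have ge1: "\<forall>\<^sub>F n in F. 1 \<le> n"
        by (rule filter_leD[OF F eventually_ge_at_top])
      define M where "M = 2 * (norm (u - p) * (R + norm p))"
      have inner_le: "2 * inner (u - p) (x (n + 1) - p) \<le> M" for n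
      proof -
        have "inner (u - p) (x (n + 1) - p) \<le> norm (u - p) * norm (x (n + 1) - p)"
          by (rule norm_cauchy_schwarz)
        also have "norm (x (n + 1) - p) \<le> R + norm p"
          using bounded[of "n + 1"] norm_triangle_ineq4[of "x (n + 1)" p] by simp
        finally show ?thesis
          by (simp add: M_def mult_left_mono)
      qed
      have "\<forall>\<^sub>F n in F. \<alpha> n < 1 / 2"
        using \<alpha>F by (intro order_tendstoD) auto
      with large ge1 have "\<forall>\<^sub>F n in F. norm (r n) \<le> 2 * M * \<alpha> n"
      proof eventually_elim
        case (elim n)
        have pos: "0 < \<alpha> n"
          using \<alpha>(1)[of n] elim by auto
        have "(1 - \<alpha> n) * r n / \<alpha> n \<le> M"
          using elim \<open>\<tau> > 0\<close> inner_le[of n] by (simp add: t_def)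
        then have "(1 - \<alpha> n) * r n \<le> M * \<alpha> n"
          using pos by (simp add: field_simps)
        moreover have "1 / 2 * r n \<le> (1 - \<alpha> n) * r n"
          using elim r[of n] by (intro mult_right_mono) auto
        ultimately show ?case
          using r[of n] elim by simp
      qed
      moreover have "((\<lambda>n. 2 * M * \<alpha> n) \<longlongrightarrow> 2 * M * 0) F"
        by (intro tendsto_intros \<alpha>F)
      ultimately have rF: "(r \<longlongrightarrow> 0) F"
        using Lim_null_comparison[of r "\<lambda>n. 2 * M * \<alpha> n" F] by (simp only: mult_zero_right)
      \<comment> \<open>Consecutive iterates approach each other along \<open>F\<close>, so the bound on \<open>x n\<close> carries over to
        \<open>x (n + 1)\<close>.\<close>
      have "Bfun (\<lambda>n. u - x n) F"
      proof (rule BfunI)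
        show "\<forall>\<^sub>F n in F. norm (u - x n) \<le> norm u + R"
          using ge1
        proof eventually_elim
          case (elim n)
          then show ?case
            using bounded[of n] norm_triangle_ineq4[of u "x n"] by simp
        qed
      qed
      then have "((\<lambda>n. \<alpha> n *\<^sub>R (u - x n)) \<longlongrightarrow> 0) F"
        using \<alpha>F by (auto simp: tendsto_Zfun_iff intro!: bounded_bilinear.Zfun_prod_Bfun[OF bounded_bilinear_scaleR])
      then have "((\<lambda>n. \<alpha> n *\<^sub>R (u - x n) + (1 - \<alpha> n) *\<^sub>R (y n - x n)) \<longlongrightarrow> 0 + (1 - 0) *\<^sub>R 0) F"
        by (intro tendsto_intros \<alpha>F regular[OF F rF])
      then have "((\<lambda>n. inner (u - p) (\<alpha> n *\<^sub>R (u - x n) + (1 - \<alpha> n) *\<^sub>R (y n - x n)))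
          \<longlongrightarrow> inner (u - p) (0 + (1 - 0) *\<^sub>R 0)) F"
        by (rule tendsto_inner[OF tendsto_const])
      then have "\<forall>\<^sub>F n in F. inner (u - p) (\<alpha> n *\<^sub>R (u - x n) + (1 - \<alpha> n) *\<^sub>R (y n - x n)) < \<tau> / 4"
        using \<open>\<tau> > 0\<close> by (intro order_tendstoD) auto
      moreover have "\<forall>\<^sub>F n in F. inner (u - p) (x n - p) < \<tau> / 4"
        using \<open>\<tau> > 0\<close> by (intro variational[OF F rF]) simp
      ultimately have "\<forall>\<^sub>F n in F. False"
        using large ge1
      proof eventually_elim
        case (elim n)
        have "x (n + 1) - p = \<alpha> n *\<^sub>R (u - x n) + (1 - \<alpha> n) *\<^sub>R (y n - x n) + (x n - p)"
          using rec[of n] elim by (simp add: algebra_simps)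
        then have "inner (u - p) (x (n + 1) - p)
            = inner (u - p) (\<alpha> n *\<^sub>R (u - x n) + (1 - \<alpha> n) *\<^sub>R (y n - x n)) + inner (u - p) (x n - p)"
          by (simp only: inner_add_right)
        then have "2 * inner (u - p) (x (n + 1) - p) < \<tau>"
          using elim(1,2) \<open>\<tau> > 0\<close> by linarith
        moreover have "0 \<le> (1 - \<alpha> n) * r n / \<alpha> n"
          using \<alpha>(1)[of n] r[of n] elim by auto
        ultimately show False
          using elim by (simp add: t_def)
      qed
      then have "\<forall>\<^sub>F n in sequentially. t n < \<tau>"
        by (simp add: F_def eventually_inf_principal not_le)
      with not_ev show False ..
    qed
  qed simp_all
  then have "(\<lambda>n. norm (x n - p)) \<longlonglongrightarrow> 0"
    using tendsto_real_sqrt by fastforce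
  then show ?thesis
    using tendsto_norm_zero_iff LIM_zero_iff by blast
qed

section \<open>Two averaged mappings\<close>

lemma norm_averaged_diff_Fix:
  fixes C :: "'a::real_inner set"
  assumes E: "condition_E \<mu> C G" and p: "p \<in> Fix C G" and z: "z \<in> C" and \<delta>: "\<delta> \<in> {0<..<1}"
  shows "(norm (averaged \<delta> G z - p))\<^sup>2 \<le> (norm (z - p))\<^sup>2 - \<delta> * (1 - \<delta>) * (norm (z - G z))\<^sup>2"
proof -
  have "(norm (averaged \<delta> G z - p))\<^sup>2
        = (1 - \<delta>) * (norm (z - p))\<^sup>2 + \<delta> * (norm (G z - p))\<^sup>2 - \<delta> * (1 - \<delta>) * (norm (z - G z))\<^sup>2"
    using norm_convex_combination[of p \<delta> z "G z"] by (simp add: averaged_def norm_minus_commute)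
  moreover have "\<delta> * (norm (G z - p))\<^sup>2 \<le> \<delta> * (norm (z - p))\<^sup>2"
    using \<delta> condition_E_quasi_nonexpansive[OF E p z] by (intro mult_left_mono power_mono) auto
  ultimately show ?thesis
    by (simp add: algebra_simps)
qed

lemma tendsto_zero_of_scaled_norm_square:
  fixes d :: "'i \<Rightarrow> 'a::real_normed_vector"
  assumes "c > 0" "((\<lambda>n. c * (norm (d n))\<^sup>2) \<longlongrightarrow> 0) F"
  shows "(d \<longlongrightarrow> 0) F"
proof -
  have "((\<lambda>n. inverse c * (c * (norm (d n))\<^sup>2)) \<longlongrightarrow> inverse c * 0) F"
    by (intro tendsto_intros assms)
  then have "((\<lambda>n. sqrt ((norm (d n))\<^sup>2)) \<longlongrightarrow> sqrt 0) F"
    using assms(1) by (intro tendsto_real_sqrt) (simp add: mult.assoc[symmetric])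
  then show ?thesis
    using tendsto_norm_zero_cancel by auto
qed

text \<open>
  Only condition (E) is demanded of the two maps, which makes the setting symmetric: exchanging
  \<open>T\<close> with \<open>S\<close> and \<open>\<beta>\<close> with \<open>1 - \<beta>\<close> reduces the case of vanishing \<open>\<beta>\<close> to the case of vanishing
  \<open>1 - \<beta>\<close>.
\<close>

locale halpern_iteration =
  fixes C :: "'a::{real_inner, complete_space} set"
    and T S :: "'a \<Rightarrow> 'a"
    and \<mu> \<nu> \<delta> :: real
    and \<alpha> \<beta> :: "nat \<Rightarrow> real"
    and u :: 'a
    and x :: "nat \<Rightarrow> 'a"
  assumes C: "closed C" "convex C"
    and maps: "T \<in> C \<rightarrow> C" "S \<in> C \<rightarrow> C"
    and E: "condition_E \<mu> C T" "condition_E \<nu> C S"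
    and common: "Fix C T \<inter> Fix C S \<noteq> {}"
    and \<delta>: "\<delta> \<in> {0<..<1}"
    and \<alpha>: "\<And>n. n \<ge> 1 \<Longrightarrow> \<alpha> n \<in> {0<..<1}" "\<alpha> \<longlonglongrightarrow> 0"
    and div: "filterlim (\<lambda>N. \<Sum>n=1..N. \<alpha> n) at_top sequentially"
    and \<beta>: "\<And>n. n \<ge> 1 \<Longrightarrow> \<beta> n \<in> {0..1}"
    and start: "u \<in> C" "x 1 \<in> C"
    and rec: "\<And>n. n \<ge> 1 \<Longrightarrow> x (n + 1) = \<alpha> n *\<^sub>R u
           + (1 - \<alpha> n) *\<^sub>R (\<beta> n *\<^sub>R averaged \<delta> T (x n) + (1 - \<beta> n) *\<^sub>R averaged \<delta> S (x n))"
begin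

definition y :: "nat \<Rightarrow> 'a" where
  "y n = \<beta> n *\<^sub>R averaged \<delta> T (x n) + (1 - \<beta> n) *\<^sub>R averaged \<delta> S (x n)"

lemma swap: "halpern_iteration C S T \<nu> \<mu> \<delta> \<alpha> (\<lambda>n. 1 - \<beta> n) u x"
  using C maps E common \<delta> \<alpha> div \<beta> start rec
  by unfold_locales (auto simp: Int_commute add.commute)

lemma averaged_in:
  assumes "z \<in> C"
  shows "averaged \<delta> T z \<in> C" "averaged \<delta> S z \<in> C"
  unfolding averaged_def
  using assms maps \<delta> by (auto intro!: convexD_alt[OF C(2)])

lemma y_in:
  assumes "n \<ge> 1" "x n \<in> C"
  shows "y n \<in> C"
proof -
  have "(1 - (1 - \<beta> n)) *\<^sub>R averaged \<delta> T (x n) + (1 - \<beta> n) *\<^sub>R averaged \<delta> S (x n) \<in> C"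
    using averaged_in[OF assms(2)] \<beta>[OF assms(1)] by (intro convexD_alt[OF C(2)]) auto
  then show ?thesis
    by (simp add: y_def)
qed

lemma rec_y: "n \<ge> 1 \<Longrightarrow> x (n + 1) = \<alpha> n *\<^sub>R u + (1 - \<alpha> n) *\<^sub>R y n"
  using rec by (simp add: y_def)

lemma x_in:
  assumes "n \<ge> 1"
  shows "x n \<in> C"
  using assms
proof (induction n rule: dec_induct)
  case base
  show ?case by (rule start)
next
  case (step n)
  have "(1 - (1 - \<alpha> n)) *\<^sub>R u + (1 - \<alpha> n) *\<^sub>R y n \<in> C"
    using \<alpha>(1)[of n] step y_in[of n] start by (intro convexD_alt[OF C(2)]) auto
  then show ?case
    using rec_y[of n] step by simp
qed

lemma norm_y_diff:
  assumes "n \<ge> 1"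
  shows "(norm (y n - p))\<^sup>2 \<le> \<beta> n * (norm (averaged \<delta> T (x n) - p))\<^sup>2
           + (1 - \<beta> n) * (norm (averaged \<delta> S (x n) - p))\<^sup>2"
proof -
  have "0 \<le> (1 - \<beta> n) * \<beta> n * (norm (averaged \<delta> T (x n) - averaged \<delta> S (x n)))\<^sup>2"
    using \<beta>[OF assms] by simp
  then show ?thesis
    using norm_convex_combination[of p "1 - \<beta> n" "averaged \<delta> T (x n)" "averaged \<delta> S (x n)"]
    by (simp add: y_def norm_minus_commute)
qed

lemma y_diff_x:
  "y n - x n = - \<delta> *\<^sub>R (\<beta> n *\<^sub>R (x n - T (x n)) + (1 - \<beta> n) *\<^sub>R (x n - S (x n)))"
  by (simp add: y_def averaged_def algebra_simps)

lemma norm_averaged_le: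
  assumes "q \<in> Fix C T \<inter> Fix C S" "n \<ge> 1"
  shows "norm (averaged \<delta> T (x n) - q) \<le> norm (x n - q)"
    and "norm (averaged \<delta> S (x n) - q) \<le> norm (x n - q)"
proof -
  have le: "norm (averaged \<delta> G (x n) - q) \<le> norm (x n - q)"
    if "condition_E \<kappa> C G" "q \<in> Fix C G" for \<kappa> G
  proof (rule power2_le_imp_le)
    have "0 \<le> \<delta> * (1 - \<delta>) * (norm (x n - G (x n)))\<^sup>2"
      using \<delta> by auto
    then show "(norm (averaged \<delta> G (x n) - q))\<^sup>2 \<le> (norm (x n - q))\<^sup>2"
      using norm_averaged_diff_Fix[OF that x_in[OF assms(2)] \<delta>] by linarith
  qed simp
  show "norm (averaged \<delta> T (x n) - q) \<le> norm (x n - q)"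
    "norm (averaged \<delta> S (x n) - q) \<le> norm (x n - q)"
    using le E assms(1) by blast+
qed

text \<open>
  The averaged maps do not increase the distance to \<open>q\<close>, and balls around \<open>q\<close> are convex.
\<close>

lemma norm_x_diff_common:
  assumes q: "q \<in> Fix C T \<inter> Fix C S" and "n \<ge> 1"
  shows "norm (x n - q) \<le> max (norm (u - q)) (norm (x 1 - q))" (is "_ \<le> ?R")
  using assms(2)
proof (induction n rule: dec_induct)
  case (step n)
  have b: "\<beta> n \<ge> 0" "\<beta> n \<le> 1" and a: "0 \<le> \<alpha> n" "\<alpha> n \<le> 1"
    using \<beta>[of n] \<alpha>(1)[of n] step by auto
  have "y n - q = \<beta> n *\<^sub>R (averaged \<delta> T (x n) - q) + (1 - \<beta> n) *\<^sub>R (averaged \<delta> S (x n) - q)"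
    by (simp add: y_def algebra_simps)
  also have "norm \<dots> \<le> \<beta> n * norm (averaged \<delta> T (x n) - q) + (1 - \<beta> n) * norm (averaged \<delta> S (x n) - q)"
    using b by (intro norm_triangle_le) simp
  also have "\<dots> \<le> ?R"
    using b step.IH norm_averaged_le[OF q step.hyps(1)] by (intro convex_bound_le) auto
  finally have y: "norm (y n - q) \<le> ?R" .
  have "x (n + 1) - q = \<alpha> n *\<^sub>R (u - q) + (1 - \<alpha> n) *\<^sub>R (y n - q)"
    using step.hyps by (simp add: rec_y[simplified] algebra_simps)
  also have "norm \<dots> \<le> \<alpha> n * norm (u - q) + (1 - \<alpha> n) * norm (y n - q)"
    using a by (intro norm_triangle_le) simp
  also have "\<dots> \<le> ?R"
    using a y by (intro convex_bound_le) auto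
  finally show ?case by simp
qed simp

lemma iterates_bounded:
  obtains R where "\<And>n. n \<ge> 1 \<Longrightarrow> norm (x n) \<le> R"
    "\<And>n. n \<ge> 1 \<Longrightarrow> norm (averaged \<delta> S (x n)) \<le> R"
    "\<And>n. n \<ge> 1 \<Longrightarrow> norm (x n - S (x n)) \<le> R"
proof -
  obtain q where q: "q \<in> Fix C T \<inter> Fix C S"
    using common by blast
  define R where "R = max (norm (u - q)) (norm (x 1 - q))"
  have R: "norm (x n - q) \<le> R" if "n \<ge> 1" for n
    unfolding R_def by (rule norm_x_diff_common[OF q that])
  have "R \<ge> 0"
    using R[of 1] norm_ge_zero[of "x 1 - q"] by linarith
  show thesis
  proof
    fix n :: nat assume n: "n \<ge> 1"
    show "norm (x n) \<le> 2 * R + norm q"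
      using R[OF n] norm_triangle_ineq[of "x n - q" q] \<open>R \<ge> 0\<close> by simp
    show "norm (averaged \<delta> S (x n)) \<le> 2 * R + norm q"
      using R[OF n] norm_averaged_le(2)[OF q n] norm_triangle_ineq[of "averaged \<delta> S (x n) - q" q]
        \<open>R \<ge> 0\<close> by simp
    have "norm (S (x n) - q) \<le> R"
      using condition_E_quasi_nonexpansive[OF E(2) _ x_in[OF n], of q] q R[OF n] by simp
    then show "norm (x n - S (x n)) \<le> 2 * R + norm q"
      using R[OF n] norm_triangle_ineq4[of "x n - q" "S (x n) - q"] norm_ge_zero[of q]
      by (simp del: norm_ge_zero)
  qed
qed

lemma subfilter_Bfun:
  assumes "F \<le> sequentially"
  shows "Bfun x F"
proof -
  obtain R where "\<And>n. n \<ge> 1 \<Longrightarrow> norm (x n) \<le> R"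
    using iterates_bounded by metis
  then show ?thesis
    by (intro BfunI[of _ R] filter_leD[OF assms]) (auto simp: eventually_sequentially)
qed

lemma subfilter_in_C:
  assumes "F \<le> sequentially"
  shows "\<forall>\<^sub>F n in F. x n \<in> C"
  by (rule filter_leD[OF assms]) (use x_in in \<open>auto simp: eventually_sequentially\<close>)

text \<open>
  The limit \<open>p\<close> is fixed by \<open>T\<close> but perhaps not by \<open>S\<close>. The contribution of \<open>S\<close> is bounded by a constant
  times \<open>1 - \<beta> n\<close>, which is summable and serves as the perturbation \<open>\<epsilon>\<close>; the common fixed point
  supplies the boundedness of the iterates.
\<close>

lemma convergence_dominant_map:
  assumes "summable (\<lambda>n. 1 - \<beta> (n + 1))"
  shows "\<exists>p\<in>Fix C T. x \<longlonglongrightarrow> p"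
proof -
  have \<beta>_summable: "summable (\<lambda>n. 1 - \<beta> n)"
    using assms summable_Suc_iff[of "\<lambda>n. 1 - \<beta> n"] by simp
  obtain R where R: "\<And>n. n \<ge> 1 \<Longrightarrow> norm (x n) \<le> R"
    "\<And>n. n \<ge> 1 \<Longrightarrow> norm (averaged \<delta> S (x n)) \<le> R"
    "\<And>n. n \<ge> 1 \<Longrightarrow> norm (x n - S (x n)) \<le> R"
    using iterates_bounded by metis
  obtain p where p: "p \<in> Fix C T" "\<And>z. z \<in> Fix C T \<Longrightarrow> inner (u - p) (z - p) \<le> 0"
    using nearest_point_exists[OF closed_Fix[OF E(1) C(1)] convex_Fix[OF E(1) C(2)]] common by blast
  define r where "r n = \<delta> * (1 - \<delta>) * (norm (x n - T (x n)))\<^sup>2" for n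
  have residual: "((\<lambda>n. x n - T (x n)) \<longlongrightarrow> 0) F" if "(r \<longlongrightarrow> 0) F" for F
    by (rule tendsto_zero_of_scaled_norm_square[of "\<delta> * (1 - \<delta>)"]) (use \<delta> that in \<open>auto simp: r_def[abs_def]\<close>)
  have "x \<longlonglongrightarrow> p"
  proof (rule halpern_convergence[OF \<alpha> div rec_y R(1)])
    fix n :: nat assume n: "n \<ge> 1"
    have b: "\<beta> n \<ge> 0" "\<beta> n \<le> 1"
      using \<beta>[OF n] by auto
    have "norm (averaged \<delta> S (x n) - p) \<le> R + norm p"
      using R(2)[OF n] norm_triangle_ineq4[of "averaged \<delta> S (x n)" p] by simp
    then have "(norm (averaged \<delta> S (x n) - p))\<^sup>2 \<le> (R + norm p)\<^sup>2"
      by (simp add: power_mono)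
    then have "(1 - \<beta> n) * (norm (averaged \<delta> S (x n) - p))\<^sup>2 \<le> (1 - \<beta> n) * (R + norm p)\<^sup>2"
      using b by (intro mult_left_mono) auto
    moreover have "\<beta> n * (norm (averaged \<delta> T (x n) - p))\<^sup>2 \<le> 1 * (norm (averaged \<delta> T (x n) - p))\<^sup>2"
      using b by (intro mult_right_mono) auto
    ultimately show "(norm (y n - p))\<^sup>2 \<le> (norm (x n - p))\<^sup>2 - r n + (1 - \<beta> n) * (R + norm p)\<^sup>2"
      using norm_y_diff[OF n, of p] norm_averaged_diff_Fix[OF E(1) p(1) x_in[OF n] \<delta>]
      by (simp add: r_def)
    show "0 \<le> r n"
      using \<delta> by (simp add: r_def)
    show "0 \<le> (1 - \<beta> n) * (R + norm p)\<^sup>2"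
      using b by simp
  next
    show "summable (\<lambda>n. (1 - \<beta> n) * (R + norm p)\<^sup>2)"
      by (rule summable_mult2[OF \<beta>_summable])
  next
    fix F :: "nat filter" assume F: "F \<le> sequentially" and rF: "(r \<longlongrightarrow> 0) F"
    have \<beta>F: "((\<lambda>n. 1 - \<beta> n) \<longlongrightarrow> 0) F"
      by (rule tendsto_mono[OF F summable_LIMSEQ_zero[OF \<beta>_summable]])
    have "Bfun (\<lambda>n. x n - S (x n)) F"
      using R(3) by (intro BfunI[of _ R] filter_leD[OF F]) (auto simp: eventually_sequentially)
    then have S0: "((\<lambda>n. (1 - \<beta> n) *\<^sub>R (x n - S (x n))) \<longlongrightarrow> 0) F"
      using \<beta>F by (auto simp: tendsto_Zfun_iff intro!: bounded_bilinear.Zfun_prod_Bfun[OF bounded_bilinear_scaleR])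
    have T0: "((\<lambda>n. (1 - (1 - \<beta> n)) *\<^sub>R (x n - T (x n))) \<longlongrightarrow> (1 - 0) *\<^sub>R 0) F"
      by (intro tendsto_intros \<beta>F residual rF)
    have "((\<lambda>n. - \<delta> *\<^sub>R (\<beta> n *\<^sub>R (x n - T (x n)) + (1 - \<beta> n) *\<^sub>R (x n - S (x n))))
        \<longlongrightarrow> - \<delta> *\<^sub>R (0 + 0)) F"
      using T0 by (intro tendsto_intros S0) simp
    then show "((\<lambda>n. y n - x n) \<longlongrightarrow> 0) F"
      by (simp add: y_diff_x)
    show "\<forall>\<^sub>F n in F. inner (u - p) (x n - p) < \<tau>" if "\<tau> > 0" for \<tau>
      by (rule inner_nearest_point_eventually_less[where \<G> = "{T}",
            OF subfilter_Bfun[OF F] C subfilter_in_C[OF F]])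
        (use E residual[OF rF] p that in auto)
  qed
  with p(1) show ?thesis by blast
qed

text \<open>
  Both weights stay away from zero, so the averaged step decreases the distance to a common fixed
  point by an amount that controls the residuals of both maps, and no perturbation is left.
\<close>

lemma convergence_balanced:
  assumes "\<eta> > 0" and balanced: "\<forall>\<^sub>F n in sequentially. \<eta> \<le> \<beta> n * (1 - \<beta> n)"
  shows "\<exists>p\<in>Fix C T \<inter> Fix C S. x \<longlonglongrightarrow> p"
proof -
  obtain R where R: "\<And>n. n \<ge> 1 \<Longrightarrow> norm (x n) \<le> R"
    using iterates_bounded by metis
  have "closed (Fix C T \<inter> Fix C S)" "convex (Fix C T \<inter> Fix C S)"
    using E C by (auto intro!: closed_Int convex_Int closed_Fix convex_Fix)
  then obtain p where p: "p \<in> Fix C T \<inter> Fix C S"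
      "\<And>z. z \<in> Fix C T \<inter> Fix C S \<Longrightarrow> inner (u - p) (z - p) \<le> 0"
    using nearest_point_exists common by blast
  define r where "r n = \<delta> * (1 - \<delta>) * (\<beta> n * (norm (x n - T (x n)))\<^sup>2
                          + (1 - \<beta> n) * (norm (x n - S (x n)))\<^sup>2)" for n
  have residual: "((\<lambda>n. x n - T (x n)) \<longlongrightarrow> 0) F" "((\<lambda>n. x n - S (x n)) \<longlongrightarrow> 0) F"
    if F: "F \<le> sequentially" and rF: "(r \<longlongrightarrow> 0) F" for F
  proof -
    have "\<forall>\<^sub>F n in F. norm (\<delta> * (1 - \<delta>) * \<eta> * (norm (x n - T (x n)))\<^sup>2) \<le> r n
                    \<and> norm (\<delta> * (1 - \<delta>) * \<eta> * (norm (x n - S (x n)))\<^sup>2) \<le> r n"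
      using filter_leD[OF F balanced] filter_leD[OF F eventually_ge_at_top[of 1]]
    proof eventually_elim
      case (elim n)
      have b: "\<beta> n \<ge> 0" "\<beta> n \<le> 1"
        using \<beta>[of n] elim by auto
      have "\<beta> n * (1 - \<beta> n) \<le> \<beta> n * 1" "\<beta> n * (1 - \<beta> n) \<le> 1 * (1 - \<beta> n)"
        using b by (intro mult_left_mono mult_right_mono; simp)+
      then have eta: "\<eta> \<le> \<beta> n" "\<eta> \<le> 1 - \<beta> n"
        using elim by auto
      have "\<eta> * (norm (x n - T (x n)))\<^sup>2 \<le> \<beta> n * (norm (x n - T (x n)))\<^sup>2"
        "\<eta> * (norm (x n - S (x n)))\<^sup>2 \<le> (1 - \<beta> n) * (norm (x n - S (x n)))\<^sup>2"
        using eta by (intro mult_right_mono; simp)+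
      moreover have "0 \<le> \<beta> n * (norm (x n - T (x n)))\<^sup>2" "0 \<le> (1 - \<beta> n) * (norm (x n - S (x n)))\<^sup>2"
        using b by simp_all
      ultimately have "\<delta> * (1 - \<delta>) * (\<eta> * (norm (x n - T (x n)))\<^sup>2) \<le> r n"
        "\<delta> * (1 - \<delta>) * (\<eta> * (norm (x n - S (x n)))\<^sup>2) \<le> r n"
        unfolding r_def using \<delta> by (intro mult_left_mono; simp)+
      then show ?case
        using \<delta> \<open>\<eta> > 0\<close> by (simp add: abs_mult mult.assoc)
    qed
    then have "((\<lambda>n. \<delta> * (1 - \<delta>) * \<eta> * (norm (x n - T (x n)))\<^sup>2) \<longlongrightarrow> 0) F"
      "((\<lambda>n. \<delta> * (1 - \<delta>) * \<eta> * (norm (x n - S (x n)))\<^sup>2) \<longlongrightarrow> 0) F"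
      using rF by (auto intro!: Lim_null_comparison[where g = r] elim: eventually_mono)
    then show "((\<lambda>n. x n - T (x n)) \<longlongrightarrow> 0) F" "((\<lambda>n. x n - S (x n)) \<longlongrightarrow> 0) F"
      using \<delta> \<open>\<eta> > 0\<close> by (auto intro!: tendsto_zero_of_scaled_norm_square[of "\<delta> * (1 - \<delta>) * \<eta>"])
  qed
  have "x \<longlonglongrightarrow> p"
  proof (rule halpern_convergence[OF \<alpha> div rec_y R])
    fix n :: nat assume n: "n \<ge> 1"
    have b: "\<beta> n \<ge> 0" "\<beta> n \<le> 1"
      using \<beta>[OF n] by auto
    have "(norm (y n - p))\<^sup>2 \<le> \<beta> n * (norm (averaged \<delta> T (x n) - p))\<^sup>2
            + (1 - \<beta> n) * (norm (averaged \<delta> S (x n) - p))\<^sup>2"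
      by (rule norm_y_diff[OF n])
    also have "\<dots> \<le> \<beta> n * ((norm (x n - p))\<^sup>2 - \<delta> * (1 - \<delta>) * (norm (x n - T (x n)))\<^sup>2)
            + (1 - \<beta> n) * ((norm (x n - p))\<^sup>2 - \<delta> * (1 - \<delta>) * (norm (x n - S (x n)))\<^sup>2)"
      using b p(1) norm_averaged_diff_Fix[OF E(1) _ x_in[OF n] \<delta>]
        norm_averaged_diff_Fix[OF E(2) _ x_in[OF n] \<delta>]
      by (intro add_mono mult_left_mono) auto
    also have "\<dots> = (norm (x n - p))\<^sup>2 - r n + 0"
      unfolding r_def by algebra
    finally show "(norm (y n - p))\<^sup>2 \<le> (norm (x n - p))\<^sup>2 - r n + 0" .
    show "0 \<le> r n"
      using \<delta> b by (simp add: r_def)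
  next
    fix F :: "nat filter" assume F: "F \<le> sequentially" and rF: "(r \<longlongrightarrow> 0) F"
    have "((\<lambda>n. norm (x n - T (x n)) + norm (x n - S (x n))) \<longlongrightarrow> norm (0::'a) + norm (0::'a)) F"
      by (intro tendsto_intros residual F rF)
    moreover have "\<forall>\<^sub>F n in F. norm (y n - x n) \<le> norm (x n - T (x n)) + norm (x n - S (x n))"
      using filter_leD[OF F eventually_ge_at_top[of 1]]
    proof eventually_elim
      case (elim n)
      have b: "\<beta> n \<ge> 0" "\<beta> n \<le> 1"
        using \<beta>[of n] elim by auto
      have "norm (y n - x n) \<le> 1 * norm (\<beta> n *\<^sub>R (x n - T (x n)) + (1 - \<beta> n) *\<^sub>R (x n - S (x n)))"
        unfolding y_diff_x norm_scaleR using \<delta> by (intro mult_right_mono) auto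
      also have "\<dots> \<le> \<beta> n * norm (x n - T (x n)) + (1 - \<beta> n) * norm (x n - S (x n))"
        using b norm_triangle_ineq[of "\<beta> n *\<^sub>R (x n - T (x n))" "(1 - \<beta> n) *\<^sub>R (x n - S (x n))"] by simp
      also have "\<dots> \<le> 1 * norm (x n - T (x n)) + 1 * norm (x n - S (x n))"
        using b by (intro add_mono mult_right_mono) auto
      finally show ?case by simp
    qed
    ultimately show "((\<lambda>n. y n - x n) \<longlongrightarrow> 0) F"
      using Lim_null_comparison[of "\<lambda>n. y n - x n" "\<lambda>n. norm (x n - T (x n)) + norm (x n - S (x n))" F]
      by simp
    show "\<forall>\<^sub>F n in F. inner (u - p) (x n - p) < \<tau>" if "\<tau> > 0" for \<tau>
      by (rule inner_nearest_point_eventually_less[where \<G> = "{T, S}",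
            OF subfilter_Bfun[OF F] C subfilter_in_C[OF F]])
        (use E residual[OF F rF] p that in auto)
  qed simp_all
  with p(1) show ?thesis by blast
qed

end

theorem theorem3p1:
  fixes C :: "'a::{real_inner, complete_space} set"
    and T S :: "'a \<Rightarrow> 'a"
    and \<delta> :: real
    and \<alpha> \<beta> :: "nat \<Rightarrow> real"
    and u :: 'a
    and x :: "nat \<Rightarrow> 'a"
  assumes "C \<noteq> {}" and "closed C" and "convex C"
    and "T \<in> C \<rightarrow> C" and "nonexpansive_on C T"
    and "S \<in> C \<rightarrow> C" and "nonspreading_on C S"
    and "Fix C S \<inter> Fix C T \<noteq> {}"
    and "\<delta> \<in> {0<..<1}"
    and "\<forall>n\<ge>1. \<alpha> n \<in> {0<..<1}"
    and "\<alpha> \<longlonglongrightarrow> 0"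
    and "filterlim (\<lambda>N. \<Sum>n=1..N. \<alpha> n) at_top sequentially"
    and "\<forall>n\<ge>1. \<beta> n \<in> {0..1}"
    and "u \<in> C" and "x 1 \<in> C"
    and "\<forall>n\<ge>1. x (n + 1) = \<alpha> n *\<^sub>R u
           + (1 - \<alpha> n) *\<^sub>R (\<beta> n *\<^sub>R averaged \<delta> T (x n) + (1 - \<beta> n) *\<^sub>R averaged \<delta> S (x n))"
  shows "(summable (\<lambda>n. 1 - \<beta> (n + 1)) \<longrightarrow> (\<exists>p \<in> Fix C T. x \<longlonglongrightarrow> p))
       \<and> (summable (\<lambda>n. \<beta> (n + 1)) \<longrightarrow> (\<exists>p \<in> Fix C S. x \<longlonglongrightarrow> p))
       \<and> (liminf (\<lambda>n. ereal (\<beta> n * (1 - \<beta> n))) > 0 \<longrightarrow> (\<exists>p \<in> Fix C T \<inter> Fix C S. x \<longlonglongrightarrow> p))"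
proof -
  interpret halpern_iteration C T S 1 4 \<delta> \<alpha> \<beta> u x
    using assms nonexpansive_condition_E[OF assms(5)] nonspreading_condition_E[OF assms(7)]
    by unfold_locales (auto simp: Int_commute)
  interpret swapped: halpern_iteration C S T 4 1 \<delta> \<alpha> "\<lambda>n. 1 - \<beta> n" u x
    by (rule swap)
  have "\<exists>p\<in>Fix C T \<inter> Fix C S. x \<longlonglongrightarrow> p" if liminf: "liminf (\<lambda>n. ereal (\<beta> n * (1 - \<beta> n))) > 0"
  proof -
    obtain \<eta> where \<eta>: "0 < ereal \<eta>" "ereal \<eta> < liminf (\<lambda>n. ereal (\<beta> n * (1 - \<beta> n)))"
      using ereal_dense2[OF liminf] by blast
    have "\<forall>\<^sub>F n in sequentially. \<eta> \<le> \<beta> n * (1 - \<beta> n)"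
      using less_LiminfD[OF \<eta>(2)] by (auto elim: eventually_mono)
    with \<eta>(1) show ?thesis
      by (intro convergence_balanced) auto
  qed
  then show ?thesis
    using convergence_dominant_map swapped.convergence_dominant_map by simp
qed

end
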